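(* Let $N\in\mathbb N$, $\tau\in(0,1/2)$, $\delta=\tau N$, $\lambda\ge 0$, $L=N(1+\lambda)$, $m\in\mathbb N\setminus\{1\}$, and $f\in\mathcal B_\delta(\mathbb R)$. Let $\varepsilon>0$ and $\tilde f_\ell=f\big(\frac{\ell}{L}\big)+\varepsilon_\ell$ with $|\varepsilon_\ell|\le\varepsilon$ for all $\ell\in\mathbb Z$. Let $\varphi_{\mathrm{Gauss}}(x)=\mathrm e^{-x^2/(2\sigma^2)}$ with $\sigma=\sqrt{\frac{m}{\pi L(L-2\delta)}}$, and let $R_{\mathrm{Gauss},m}f$ and $R_{\mathrm{Gauss},m}\tilde f$ be the corresponding regularized Shannon sampling formulas with exact and with noisy samples. Then $$\|R_{\mathrm{Gauss},m}\tilde f-R_{\mathrm{Gauss},m}f\|_{C_0(\mathbb R)}\le\varepsilon\left(2+\sqrt{\frac{2+2\lambda}{\lambda+1-2\tau}}\,\sqrt m\right).$$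
   Context: $\mathrm{sinc}\,x=\frac{\sin x}{x}$ for $x\ne0$ and $\mathrm{sinc}\,0=1$. $\|g\|_{C_0(\mathbb R)}:=\max_{t\in\mathbb R}|g(t)|$ (read as a supremum if the maximum is not attained). Fourier transform: $\hat f(v)=\int_{\mathbb R}f(t)\,\mathrm e^{-2\pi\mathrm i tv}\,\mathrm dt$ (extended to $L^2(\mathbb R)$ by Plancherel). Paley--Wiener space: $\mathcal B_\delta(\mathbb R)=\{f\in L^2(\mathbb R):\ \mathrm{supp}\,\hat f\subseteq[-\delta,\delta]\}$; each element is identified with its smooth representative, so point values make sense. For a real or complex sequence $(g_\ell)_{\ell\in\mathbb Z}$ the regularized Shannon sampling formula with localized sampling for the Gaussian window is $$t\mapsto\sum_{\ell\in\mathbb Z}g_\ell\,\mathrm{sinc}\big(L\pi(t-\tfrac{\ell}{L})\big)\,\varphi_{\mathrm{Gauss}}\big(t-\tfrac{\ell}{L}\big)\,\mathbf 1_{[-m/L,m/L]}\big(t-\tfrac{\ell}{L}\big),\quad t\in\mathbb R,$$ where $\mathbf 1_{[-m/L,m/L]}$ is the indicator function of $[-m/L,m/L]$; it is denoted $R_{\mathrm{Gauss},m}f$ when $g_\ell=f(\ell/L)$ and $R_{\mathrm{Gauss},m}\tilde f$ when $g_\ell=\tilde f_\ell$. *)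

theory Defs
  imports "HOL-Probability.Sinc_Integral"
begin

definition L2 :: "(real \<Rightarrow> complex) set" where
  "L2 = {f. f \<in> borel_measurable lborel \<and> integrable lborel (\<lambda>t. (cmod (f t))\<^sup>2)}"

text \<open>The square of the L2 distance. As a nonnegative integral it is infinite, rather than 0, when
  the difference is not square-integrable.\<close>

definition L2_dist_sq :: "(real \<Rightarrow> complex) \<Rightarrow> (real \<Rightarrow> complex) \<Rightarrow> ennreal" where
  "L2_dist_sq f g = (\<integral>\<^sup>+ t. ennreal ((cmod (f t - g t))\<^sup>2) \<partial>lborel)"

definition fourier_L1 :: "(real \<Rightarrow> complex) \<Rightarrow> real \<Rightarrow> complex" where
  "fourier_L1 f v = (\<integral>t. f t * exp (- 2 * of_real pi * \<i> * of_real t * of_real v) \<partial>lborel)"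

text \<open>\<open>g\<close> is (a representative of) the Fourier transform of \<open>f\<close> in L2, i.e. of the continuous
  extension of the Fourier integral from the intersection of L1 and L2 to L2 given by Plancherel's
  theorem; \<open>g\<close> is determined by \<open>f\<close> up to null sets.\<close>

definition is_fourier_L2 :: "(real \<Rightarrow> complex) \<Rightarrow> (real \<Rightarrow> complex) \<Rightarrow> bool" where
  "is_fourier_L2 f g \<longleftrightarrow> f \<in> L2 \<and> g \<in> L2 \<and>
     (\<exists>h :: nat \<Rightarrow> real \<Rightarrow> complex.
        (\<forall>n. integrable lborel (h n) \<and> h n \<in> L2) \<and>
        (\<lambda>n. L2_dist_sq (h n) f) \<longlonglongrightarrow> 0 \<and>
        (\<lambda>n. L2_dist_sq (fourier_L1 (h n)) g) \<longlonglongrightarrow> 0)"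

definition smooth :: "(real \<Rightarrow> complex) \<Rightarrow> bool" where
  "smooth f \<longleftrightarrow> (\<exists>D :: nat \<Rightarrow> real \<Rightarrow> complex. D 0 = f \<and>
     (\<forall>k t. (D k has_vector_derivative D (Suc k) t) (at t)))"

text \<open>An element of the Paley--Wiener space is an L2 class, identified here with its unique smooth
  representative. The support condition refers to the essential support of the Fourier transform,
  which lies in the closed interval iff the transform vanishes almost everywhere outside it.\<close>

definition paley_wiener :: "real \<Rightarrow> (real \<Rightarrow> complex) set" where
  "paley_wiener \<delta> = {f \<in> L2. smooth f \<and>
     (\<exists>g. is_fourier_L2 f g \<and> (AE v in lborel. v \<notin> {-\<delta>..\<delta>} \<longrightarrow> g v = 0))}"

definition gauss_window :: "real \<Rightarrow> real \<Rightarrow> real" where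
  "gauss_window \<sigma> x = exp (- x\<^sup>2 / (2 * \<sigma>\<^sup>2))"

text \<open>For \<open>L > 0\<close> only finitely many summands are nonzero at each \<open>t\<close>, so the unordered
  infinite sum is a finite sum.\<close>

definition reg_shannon ::
    "(real \<Rightarrow> real) \<Rightarrow> real \<Rightarrow> nat \<Rightarrow> (int \<Rightarrow> complex) \<Rightarrow> real \<Rightarrow> complex" where
  "reg_shannon \<phi> L m g t =
     (\<Sum>\<^sub>\<infinity>l\<in>(UNIV :: int set). g l *
        of_real (sinc (L * pi * (t - of_int l / L)) * \<phi> (t - of_int l / L) *
          indicator {- real m / L..real m / L} (t - of_int l / L)))"

text \<open>The supremum is taken in the extended reals, so it is infinite for unbounded \<open>g\<close>.\<close>

definition C0_norm :: "(real \<Rightarrow> complex) \<Rightarrow> ereal" where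
  "C0_norm g = (SUP t. ereal (cmod (g t)))"

end

theory Submission
  imports Defs
begin

text \<open>
  The reconstruction is linear in the samples, so the difference of the two formulas is the
  formula applied to the perturbations \<open>\<epsilon>\<^sub>s\<close>. The claim therefore bounds the operator
  norm of the formula, from bounded sequences to bounded functions. As
  \<open>\<bar>sinc\<bar> \<le> 1\<close>, this norm is at most the supremum over \<open>t\<close> of the truncated sums of
  \<open>\<phi> (t - l / L)\<close> over the integers \<open>l\<close> (lemma \<open>reg_shannon_cmod_le\<close>).

  Put \<open>u = L t\<close>. As a function of the integer \<open>l\<close>, the summand is the Gaussian with mean \<open>u\<close> and
  standard deviation \<open>s = \<sigma> L\<close>, scaled to have maximum \<open>1\<close>. The two integers next to
  \<open>u\<close> contribute at most \<open>1\<close> each. Every other term is at most the integral of the Gaussian over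
  the unit interval that leads from \<open>l\<close> towards \<open>u\<close>, and these intervals do not overlap, so
  together they contribute at most \<open>sqrt (2 * pi) * s\<close> (lemmas \<open>unimodal_sum_le_integral\<close> and
  \<open>gauss_sum_le\<close>). The choice of \<open>\<sigma>\<close> turns this integral into the square root in the claim.
\<close>

text \<open>
  Sum--integral comparison for a function that rises up to \<open>u\<close> and falls afterwards. Away from the
  two integers next to \<open>u\<close>, the value at \<open>l\<close> bounds \<open>g\<close> from below on the unit interval
  that ends at \<open>l\<close> on the side facing \<open>u\<close>. The intervals for different \<open>l\<close> are disjoint because
  the interval containing \<open>u\<close> separates the two sides.
\<close>

lemma unimodal_sum_le_integral:
  fixes g :: "real \<Rightarrow> real" and u :: real and F :: "int set"
  assumes fin: "finite F"
    and int: "integrable lborel g"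
    and nonneg: "\<And>x. 0 \<le> g x"
    and up: "\<And>x y. x \<le> y \<Longrightarrow> y \<le> u \<Longrightarrow> g x \<le> g y"
    and down: "\<And>x y. u \<le> x \<Longrightarrow> x \<le> y \<Longrightarrow> g y \<le> g x"
  shows "(\<Sum>l\<in>F. g (of_int l)) \<le> 2 * g u + (\<integral>x. g x \<partial>lborel)"
proof -
  define P where "P = {\<lfloor>u\<rfloor>, \<lfloor>u\<rfloor> + 1}"
  define G where "G = F - P"
  \<comment> \<open>The left endpoint of the unit interval assigned to \<open>l\<close>.\<close>
  define c :: "int \<Rightarrow> int" where "c l = (if l > \<lfloor>u\<rfloor> then l - 1 else l)" for l
  have finG: "finite G" using fin by (simp add: G_def)
  have g_max: "g x \<le> g u" for x
    using up[of x u] down[of u x] by linarith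
  have inj: "inj_on c G"
    by (auto simp: inj_on_def c_def G_def P_def split: if_splits)
  have below: "g (of_int l) \<le> g x" if l: "l \<in> G" and x: "x \<in> {of_int (c l)..<of_int (c l) + 1}"
    for l x
  proof (cases "l > \<lfloor>u\<rfloor>")
    case True
    then have "l \<ge> \<lfloor>u\<rfloor> + 2" using l by (auto simp: G_def P_def)
    then have "u \<le> x" "x \<le> of_int l" using x True unfolding c_def by simp_all linarith+
    then show ?thesis by (rule down)
  next
    case False
    then have "l \<le> \<lfloor>u\<rfloor> - 1" using l by (auto simp: G_def P_def)
    then have "of_int l \<le> x" "x \<le> u" using x False unfolding c_def by simp_all linarith+
    then show ?thesis by (rule up)
  qed
  define h where
    "h l x = g (of_int l) * indicator {real_of_int (c l)..<of_int (c l) + 1} x" for l x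
  have pointwise: "(\<Sum>l\<in>G. h l x) \<le> g x" for x
  proof (cases "\<exists>l\<in>G. c l = \<lfloor>x\<rfloor>")
    case True
    then obtain k where k: "k \<in> G" "c k = \<lfloor>x\<rfloor>" by blast
    have "h l x = 0" if "l \<in> G - {k}" for l
    proof -
      have "c l \<noteq> \<lfloor>x\<rfloor>" using that k inj by (auto simp: inj_on_def)
      then show ?thesis by (auto simp: h_def indicator_def floor_unique)
    qed
    then have "(\<Sum>l\<in>G. h l x) = h k x"
      using k finG by (simp add: sum.remove)
    also have "\<dots> \<le> g x"
      using below[OF k(1)] nonneg[of x] by (auto simp: h_def indicator_def)
    finally show ?thesis .
  next
    case False
    then have "h l x = 0" if "l \<in> G" for l
      using that by (fastforce simp: h_def indicator_def intro: floor_unique[symmetric])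
    then show ?thesis using nonneg by simp
  qed
  have int_h: "integrable lborel (h l)" for l
    unfolding h_def by (intro integrable_mult_right integrable_real_indicator) auto
  have "(\<Sum>l\<in>G. g (of_int l)) = (\<Sum>l\<in>G. \<integral>x. h l x \<partial>lborel)"
    by (simp add: h_def)
  also have "\<dots> = (\<integral>x. (\<Sum>l\<in>G. h l x) \<partial>lborel)"
    by (rule Bochner_Integration.integral_sum[symmetric]) (rule int_h)
  also have "\<dots> \<le> (\<integral>x. g x \<partial>lborel)"
    by (intro integral_mono Bochner_Integration.integrable_sum int_h int pointwise)
  finally have far: "(\<Sum>l\<in>G. g (of_int l)) \<le> (\<integral>x. g x \<partial>lborel)" .
  have "(\<Sum>l\<in>F \<inter> P. g (of_int l)) \<le> (\<Sum>l\<in>P. g (of_int l))"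
    by (intro sum_mono2) (auto simp: P_def nonneg)
  also have "\<dots> \<le> 2 * g u"
    using g_max[of "of_int \<lfloor>u\<rfloor>"] g_max[of "of_int (\<lfloor>u\<rfloor> + 1)"] by (simp add: P_def)
  finally have near: "(\<Sum>l\<in>F \<inter> P. g (of_int l)) \<le> 2 * g u" .
  have "(\<Sum>l\<in>F. g (of_int l)) = (\<Sum>l\<in>F \<inter> P. g (of_int l)) + (\<Sum>l\<in>G. g (of_int l))"
    unfolding G_def by (rule sum.Int_Diff[OF fin])
  with near far show ?thesis by linarith
qed

text \<open>The integral of the unnormalized Gaussian is the inverse of the factor that makes it a
  probability density.\<close>

lemma gauss_sum_le:
  fixes u s :: real and F :: "int set"
  assumes "finite F" and s: "s > 0"
  shows "(\<Sum>l\<in>F. exp (- (of_int l - u)\<^sup>2 / (2 * s\<^sup>2))) \<le> 2 + sqrt (2 * pi) * s"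
proof -
  let ?g = "\<lambda>x. exp (- (x - u)\<^sup>2 / (2 * s\<^sup>2))"
  have g: "?g = (\<lambda>x. (sqrt (2 * pi) * s) * normal_density u s x)"
    using s by (auto simp: normal_density_def real_sqrt_mult)
  have int: "integrable lborel ?g"
    unfolding g using s by (intro integrable_mult_right integrable_normal_density)
  have val: "(\<integral>x. ?g x \<partial>lborel) = sqrt (2 * pi) * s"
    unfolding g using s by (simp add: integral_normal_density)
  have "(\<Sum>l\<in>F. ?g (of_int l)) \<le> 2 * ?g u + (\<integral>x. ?g x \<partial>lborel)"
  proof (rule unimodal_sum_le_integral[OF assms(1) int])
    fix x y :: real
    assume "x \<le> y" "y \<le> u"
    then have "(y - u)\<^sup>2 \<le> (x - u)\<^sup>2" by (intro abs_le_square_iff[THEN iffD1]) auto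
    then show "?g x \<le> ?g y" by (simp add: divide_right_mono)
  next
    fix x y :: real
    assume "u \<le> x" "x \<le> y"
    then have "(x - u)\<^sup>2 \<le> (y - u)\<^sup>2" by (intro abs_le_square_iff[THEN iffD1]) auto
    then show "?g y \<le> ?g x" by (simp add: divide_right_mono)
  qed simp
  then show ?thesis using val by simp
qed

lemma abs_sinc_le_1: "\<bar>sinc x\<bar> \<le> 1"
  using abs_sin_x_le_abs_x[of x] by (auto simp: divide_le_eq_1)

definition sample_window :: "real \<Rightarrow> nat \<Rightarrow> real \<Rightarrow> int set" where
  "sample_window L m t = {l. t - of_int l / L \<in> {- real m / L..real m / L}}"

lemma finite_sample_window:
  assumes "L > 0"
  shows "finite (sample_window L m t)"
proof (rule finite_subset)
  show "sample_window L m t \<subseteq> {\<lfloor>L * t - real m\<rfloor>..\<lceil>L * t + real m\<rceil>}"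
  proof
    fix l assume "l \<in> sample_window L m t"
    then have "- real m / L \<le> t - of_int l / L" "t - of_int l / L \<le> real m / L"
      by (auto simp: sample_window_def)
    then have "- real m \<le> L * (t - of_int l / L)" "L * (t - of_int l / L) \<le> real m"
      using assms by (simp_all add: pos_minus_divide_le_eq pos_le_divide_eq mult.commute)
    moreover have "L * (t - of_int l / L) = L * t - of_int l"
      using assms by (simp add: right_diff_distrib)
    ultimately have "L * t - real m \<le> of_int l" "of_int l \<le> L * t + real m"
      by linarith+
    then show "l \<in> {\<lfloor>L * t - real m\<rfloor>..\<lceil>L * t + real m\<rceil>}"
      by (simp add: floor_le_iff le_ceiling_iff)
  qed
qed simp

lemma reg_shannon_eq_sum:
  assumes "L > 0"
  shows "reg_shannon \<phi> L m g t = (\<Sum>l\<in>sample_window L m t.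
    g l * of_real (sinc (L * pi * (t - of_int l / L)) * \<phi> (t - of_int l / L)))"
proof -
  have "reg_shannon \<phi> L m g t = (\<Sum>\<^sub>\<infinity>l\<in>sample_window L m t.
    g l * of_real (sinc (L * pi * (t - of_int l / L)) * \<phi> (t - of_int l / L)))"
    unfolding reg_shannon_def
    by (rule infsum_cong_neutral) (auto simp: sample_window_def indicator_def)
  then show ?thesis using finite_sample_window[OF assms] by simp
qed

lemma reg_shannon_diff:
  assumes "L > 0"
  shows "reg_shannon \<phi> L m g t - reg_shannon \<phi> L m g' t = reg_shannon \<phi> L m (\<lambda>l. g l - g' l) t"
  by (simp add: reg_shannon_eq_sum[OF assms] sum_subtractf[symmetric] algebra_simps)

text \<open>Discarding the factor \<open>sinc\<close> loses the decay \<open>1 / \<bar>l\<bar>\<close> of the kernel; a Gaussian window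
  alone still keeps the sum bounded.\<close>

lemma reg_shannon_cmod_le:
  assumes "L > 0" and "\<And>l. cmod (g l) \<le> \<epsilon>" and nonneg: "\<And>x. 0 \<le> \<phi> x"
  shows "cmod (reg_shannon \<phi> L m g t) \<le> \<epsilon> * (\<Sum>l\<in>sample_window L m t. \<phi> (t - of_int l / L))"
proof -
  have eps: "0 \<le> \<epsilon>" using assms(2)[of 0] norm_ge_zero order_trans by blast
  have "cmod (g l * of_real (sinc (L * pi * (t - of_int l / L)) * \<phi> (t - of_int l / L)))
          \<le> \<epsilon> * (1 * \<phi> (t - of_int l / L))" for l
    unfolding norm_mult norm_of_real abs_mult abs_of_nonneg[OF nonneg]
    by (intro mult_mono assms(2) abs_sinc_le_1 order_refl) (auto simp: eps nonneg)
  then show ?thesis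
    unfolding reg_shannon_eq_sum[OF assms(1)] sum_distrib_left
    by (intro sum_norm_le) simp
qed

text \<open>Rescaling the argument by \<open>L\<close> multiplies the standard deviation of the window by \<open>L\<close>.\<close>

lemma reg_shannon_gauss_cmod_le:
  assumes L: "L > 0" and \<sigma>: "\<sigma> > 0" and g: "\<And>l. cmod (g l) \<le> \<epsilon>"
  shows "cmod (reg_shannon (gauss_window \<sigma>) L m g t) \<le> \<epsilon> * (2 + sqrt (2 * pi) * (\<sigma> * L))"
proof -
  have eps: "0 \<le> \<epsilon>" using g[of 0] norm_ge_zero order_trans by blast
  have "gauss_window \<sigma> (t - of_int l / L) = exp (- (of_int l - L * t)\<^sup>2 / (2 * (\<sigma> * L)\<^sup>2))" for l
  proof -
    have "(t - of_int l / L)\<^sup>2 = (of_int l - L * t)\<^sup>2 / L\<^sup>2"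
      using L by (simp add: field_simps power2_eq_square)
    then show ?thesis by (simp add: gauss_window_def power_mult_distrib mult_ac)
  qed
  then have "(\<Sum>l\<in>sample_window L m t. gauss_window \<sigma> (t - of_int l / L))
               \<le> 2 + sqrt (2 * pi) * (\<sigma> * L)"
    using gauss_sum_le[OF finite_sample_window[OF L], of "\<sigma> * L"] L \<sigma> by simp
  then have "\<epsilon> * (\<Sum>l\<in>sample_window L m t. gauss_window \<sigma> (t - of_int l / L))
               \<le> \<epsilon> * (2 + sqrt (2 * pi) * (\<sigma> * L))"
    by (rule mult_left_mono) (rule eps)
  moreover have "cmod (reg_shannon (gauss_window \<sigma>) L m g t)
               \<le> \<epsilon> * (\<Sum>l\<in>sample_window L m t. gauss_window \<sigma> (t - of_int l / L))"
    by (rule reg_shannon_cmod_le[OF L g]) (simp add: gauss_window_def)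
  ultimately show ?thesis by linarith
qed

theorem theorem4p3:
  fixes N m :: nat and \<tau> \<delta> lam L \<epsilon> \<sigma> :: real
    and f :: "real \<Rightarrow> complex" and f_noisy \<epsilon>\<^sub>s :: "int \<Rightarrow> complex"
  assumes "N \<ge> 1" and "\<tau> \<in> {0<..<1/2}" and "\<delta> = \<tau> * real N"
    and "lam \<ge> 0" and "L = real N * (1 + lam)"
    and "m \<ge> 1" and "m \<noteq> 1"
    and "f \<in> paley_wiener \<delta>"
    and "\<epsilon> > 0" and "\<And>l. f_noisy l = f (of_int l / L) + \<epsilon>\<^sub>s l"
    and "\<And>l. cmod (\<epsilon>\<^sub>s l) \<le> \<epsilon>"
    and "\<sigma> = sqrt (real m / (pi * L * (L - 2 * \<delta>)))"
  shows "C0_norm (\<lambda>t. reg_shannon (gauss_window \<sigma>) L m f_noisy t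
                     - reg_shannon (gauss_window \<sigma>) L m (\<lambda>l. f (of_int l / L)) t)
         \<le> ereal (\<epsilon> * (2 + sqrt ((2 + 2 * lam) / (lam + 1 - 2 * \<tau>)) * sqrt (real m)))"
proof -
  have N: "real N > 0" using assms(1) by simp
  have L: "L > 0" using N assms(4,5) by simp
  have gap: "lam + 1 - 2 * \<tau> > 0" using assms(2,4) by simp
  \<comment> \<open>\<open>\<sigma>\<close> is real and positive because the sampling rate \<open>L\<close> exceeds the Nyquist rate \<open>2 * \<delta>\<close>.\<close>
  have L\<delta>: "L - 2 * \<delta> = real N * (lam + 1 - 2 * \<tau>)"
    by (simp add: assms(3,5) algebra_simps)
  have \<sigma>: "\<sigma> > 0"
    unfolding assms(12) L\<delta> using assms(6) L N gap by simp
  have "sqrt (2 * pi) * (\<sigma> * L) = sqrt (2 * pi * (real m / (pi * L * (L - 2 * \<delta>))) * L\<^sup>2)"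
    unfolding assms(12) real_sqrt_mult using L by simp
  also have "2 * pi * (real m / (pi * L * (L - 2 * \<delta>))) * L\<^sup>2 = 2 * real m * L / (L - 2 * \<delta>)"
    using L by (simp add: power2_eq_square)
  also have "\<dots> = (2 + 2 * lam) / (lam + 1 - 2 * \<tau>) * real m"
  proof -
    have num: "2 * real m * L = real N * ((2 + 2 * lam) * real m)"
      by (simp add: assms(5) algebra_simps)
    show ?thesis unfolding L\<delta> num using N by simp
  qed
  finally have const: "sqrt (2 * pi) * (\<sigma> * L)
      = sqrt ((2 + 2 * lam) / (lam + 1 - 2 * \<tau>)) * sqrt (real m)"
    by (simp only: real_sqrt_mult)
  have "reg_shannon (gauss_window \<sigma>) L m f_noisy t
          - reg_shannon (gauss_window \<sigma>) L m (\<lambda>l. f (of_int l / L)) t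
        = reg_shannon (gauss_window \<sigma>) L m \<epsilon>\<^sub>s t" for t
    by (simp add: reg_shannon_diff[OF L] assms(10))
  then show ?thesis
    unfolding C0_norm_def const[symmetric]
    using reg_shannon_gauss_cmod_le[OF L \<sigma> assms(11)] by (intro SUP_least) simp
qed

end
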